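(* Let $P$ be an mca-program. A set of atoms $M$ is a stable model of $P$ if and only if $M$ is a model of $P$ and $M$ is the result of some quasi $P$-computation.
   Context: Let $\mathit{At}$ be a set of propositional atoms. An mc-atom over $\mathit{At}$ is an expression $kX$, where $k$ is a non-negative integer and $X \subseteq \mathit{At}$ is finite with $k \leq |X|$; $\mathit{aset}(kX) = X$. An mc-literal is $A$ or $\mathbf{not}(A)$ for an mc-atom $A$. An mca-clause $r$ is an expression $H \leftarrow L_1, \ldots, L_m$ ($m \geq 0$), where $H$ is an mc-atom and the $L_i$ are mc-literals, with $\mathit{hd}(r) = H$, $\mathit{bd}(r) = \{L_1, \ldots, L_m\}$, and $\mathit{hset}(r) = \mathit{aset}(H)$. An mca-program is a set of mca-clauses. It is Horn if no clause body contains a literal of the form $\mathbf{not}(A)$. For a set $Q$ of clauses, $\mathit{hset}(Q) = \bigcup\{\mathit{hset}(r) : r \in Q\}$. Satisfaction, for $M \subseteq \mathit{At}$: - $M \models kX$ iff $|M \cap X| \geq k$. - $M \models \mathbf{not}(kX)$ iff $|M \cap X| < k$. - $M \models \mathit{bd}(r)$ iff $M$ satisfies all literals of $\mathit{bd}(r)$. - $M$ satisfies $r$ if $M \models \mathit{hd}(r)$ whenever $M \models \mathit{bd}(r)$. - $M$ is a model of $P$ if it satisfies all clauses. Operators, computations and derivable models: - $Q(M) = \{r \in Q : M \models \mathit{bd}(r)\}$. - $T^{\mathit{nd}}_Q(M)$ is the set of all $M'$ with $M' \subseteq \mathit{hset}(Q(M))$ and $M' \models \mathit{hd}(r)$ for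 all $r \in Q(M)$. - For a Horn mca-program $Q$, a $Q$-computation is a sequence $(X_n)_{n \geq 0}$ with $X_0 = \emptyset$, $X_n \subseteq X_{n+1}$ and $X_{n+1} \in T^{\mathit{nd}}_Q(X_n)$. - A derivable model of $Q$ is the union of some $Q$-computation. Reduct and stable models: the reduct $P^M$ is obtained from $P$ by removing every clause whose body contains a literal $\mathbf{not}(A)$ with $M \models A$, and then deleting all literals $\mathbf{not}(A)$ from the remaining clauses. $M$ is a stable model of $P$ if $M$ is a derivable model of $P^M$. Quasi $P$-computations: a sequence $(X_n)_{n=0,1,2,\ldots}$ with $X_0 = \emptyset$ is a quasi $P$-computation if for every $n \geq 0$ there is a clause $r_n \in P$ such that: (i) $X_n \models \mathit{bd}(r_n)$; (ii) there is $X \subseteq \mathit{hset}(r_n)$ with $X \models \mathit{hd}(r_n)$ and $X_{n+1} = X_n \cup X$; (iii) for every $i = 0, 1, \ldots, n$ and every mc-atom $kY$ such that $\mathbf{not}(kY) \in \mathit{bd}(r_i)$, $X_{n+1} \not\models kY$. The result of the quasi $P$-computation is $\bigcup_{k \geq 1} X_k$.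
   Formalization: Assumes M is countable (results of quasi P-computations always are, stable models over uncountable At need not be) and, if M is empty, that some clause body of P is satisfied by the empty set (otherwise the empty set is stable but no quasi P-computation exists). *)

theory Defs
  imports "HOL-Library.Countable_Set"
begin

text \<open>The type variable \<^typ>\<open>'a\<close> plays the role of the set of propositional atoms.\<close>

typedef 'a mc_atom = "{(k :: nat, X :: 'a set). finite X \<and> k \<le> card X}"
  by (rule exI [of _ "(0, {})"]) simp

definition bound :: "'a mc_atom \<Rightarrow> nat" where
  "bound A = fst (Rep_mc_atom A)"

definition aset :: "'a mc_atom \<Rightarrow> 'a set" where
  "aset A = snd (Rep_mc_atom A)"

datatype 'a mc_literal = PosLit "'a mc_atom" | NotLit "'a mc_atom"

datatype 'a mca_clause = Clause (head: "'a mc_atom") (body: "'a mc_literal list")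

definition bd :: "'a mca_clause \<Rightarrow> 'a mc_literal set" where
  "bd r = set (body r)"

type_synonym 'a mca_program = "'a mca_clause set"

definition horn :: "'a mca_program \<Rightarrow> bool" where
  "horn Q \<longleftrightarrow> (\<forall>r\<in>Q. \<forall>A. NotLit A \<notin> bd r)"

definition hset :: "'a mca_clause \<Rightarrow> 'a set" where
  "hset r = aset (head r)"

definition hset_program :: "'a mca_program \<Rightarrow> 'a set" where
  "hset_program Q = (\<Union>r\<in>Q. hset r)"

definition sat_atom :: "'a set \<Rightarrow> 'a mc_atom \<Rightarrow> bool" where
  "sat_atom M A \<longleftrightarrow> card (M \<inter> aset A) \<ge> bound A"

fun sat_literal :: "'a set \<Rightarrow> 'a mc_literal \<Rightarrow> bool" where
  "sat_literal M (PosLit A) \<longleftrightarrow> sat_atom M A"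
| "sat_literal M (NotLit A) \<longleftrightarrow> card (M \<inter> aset A) < bound A"

definition sat_body :: "'a set \<Rightarrow> 'a mca_clause \<Rightarrow> bool" where
  "sat_body M r \<longleftrightarrow> (\<forall>L\<in>bd r. sat_literal M L)"

definition sat_clause :: "'a set \<Rightarrow> 'a mca_clause \<Rightarrow> bool" where
  "sat_clause M r \<longleftrightarrow> (sat_body M r \<longrightarrow> sat_atom M (head r))"

definition model :: "'a mca_program \<Rightarrow> 'a set \<Rightarrow> bool" where
  "model P M \<longleftrightarrow> (\<forall>r\<in>P. sat_clause M r)"

text \<open>The program written \<open>Q(M)\<close> in the literature.\<close>

definition applicable :: "'a mca_program \<Rightarrow> 'a set \<Rightarrow> 'a mca_program" where
  "applicable Q M = {r \<in> Q. sat_body M r}"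

definition Tnd :: "'a mca_program \<Rightarrow> 'a set \<Rightarrow> 'a set set" where
  "Tnd Q M = {M'. M' \<subseteq> hset_program (applicable Q M) \<and>
                  (\<forall>r\<in>applicable Q M. sat_atom M' (head r))}"

definition computation :: "'a mca_program \<Rightarrow> (nat \<Rightarrow> 'a set) \<Rightarrow> bool" where
  "computation Q X \<longleftrightarrow> horn Q \<and> X 0 = {} \<and>
     (\<forall>n. X n \<subseteq> X (Suc n) \<and> X (Suc n) \<in> Tnd Q (X n))"

definition derivable_model :: "'a mca_program \<Rightarrow> 'a set \<Rightarrow> bool" where
  "derivable_model Q M \<longleftrightarrow> (\<exists>X. computation Q X \<and> M = (\<Union>n. X n))"

definition reduct :: "'a mca_program \<Rightarrow> 'a set \<Rightarrow> 'a mca_program" where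
  "reduct P M = {Clause (head r) (filter (\<lambda>L. \<nexists>A. L = NotLit A) (body r)) | r.
                   r \<in> P \<and> \<not> (\<exists>A. NotLit A \<in> bd r \<and> sat_atom M A)}"

definition stable_model :: "'a mca_program \<Rightarrow> 'a set \<Rightarrow> bool" where
  "stable_model P M \<longleftrightarrow> derivable_model (reduct P M) M"

definition quasi_computation :: "'a mca_program \<Rightarrow> (nat \<Rightarrow> 'a set) \<Rightarrow> bool" where
  "quasi_computation P X \<longleftrightarrow> X 0 = {} \<and>
     (\<exists>r. \<forall>n. r n \<in> P \<and> sat_body (X n) (r n) \<and>
        (\<exists>Y. Y \<subseteq> hset (r n) \<and> sat_atom Y (head (r n)) \<and> X (Suc n) = X n \<union> Y) \<and>
        (\<forall>i\<le>n. \<forall>A. NotLit A \<in> bd (r i) \<longrightarrow> \<not> sat_atom (X (Suc n)) A))"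

definition quasi_result :: "(nat \<Rightarrow> 'a set) \<Rightarrow> 'a set" where
  "quasi_result X = (\<Union>k\<in>{1..}. X k)"

lemma horn_reduct: "horn (reduct P M)"
  by (auto simp: horn_def reduct_def bd_def)

text \<open>
  Two boundary phenomena. Every step of a quasi-computation adds finitely many atoms, so
  its result is countable, whereas stable models over uncountably many atoms need not be.
  Moreover, every step, including the first, uses a clause of the program, so there is no
  quasi-computation if no body is satisfied by the empty set; the empty set is then
  nevertheless a stable model.
\<close>

lemma finite_aset: "finite (aset A)"
  using Rep_mc_atom [of A] by (auto simp: aset_def)

lemma countable_quasi_result:
  assumes "quasi_computation P X"
  shows "countable (quasi_result X)"
proof -
  have "finite (X n)" for n
  proof (induction n)
    case 0
    show ?case using assms by (simp add: quasi_computation_def)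
  next
    case (Suc n)
    from assms obtain r Y where "Y \<subseteq> hset (r :: 'a mca_clause)" "X (Suc n) = X n \<union> Y"
      unfolding quasi_computation_def by blast
    then show ?case using Suc
      by (metis finite_UnI finite_aset finite_subset hset_def)
  qed
  then show ?thesis
    unfolding quasi_result_def by (simp add: countable_finite)
qed

lemma uncountable_stable_model:
  "stable_model (range (\<lambda>a. Clause (Abs_mc_atom (1, {a})) [])) UNIV"
proof -
  let ?P = "range (\<lambda>a :: 'a. Clause (Abs_mc_atom (1, {a})) [])"
  let ?X = "\<lambda>n :: nat. if n = 0 then {} else UNIV :: 'a set"
  have [simp]: "Rep_mc_atom (Abs_mc_atom (Suc 0, {a})) = (Suc 0, {a})" for a :: 'a
    by (rule Abs_mc_atom_inverse) simp
  have r: "reduct ?P UNIV = ?P"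
    by (force simp: reduct_def bd_def)
  have a: "applicable ?P M = ?P" for M
    by (auto simp: applicable_def sat_body_def bd_def)
  have "UNIV \<in> Tnd ?P M" for M
    unfolding Tnd_def a
    by (auto simp: hset_program_def hset_def aset_def sat_atom_def bound_def)
  then have "computation ?P ?X"
    using horn_reduct [of ?P UNIV] unfolding r computation_def by simp
  moreover have "UNIV = (\<Union>n. ?X n)"
    by auto
  ultimately show ?thesis
    unfolding stable_model_def derivable_model_def r by blast
qed

lemma no_quasi_computation:
  assumes "applicable P {} = {}"
  shows "stable_model P {}" and "\<not> quasi_computation P X"
proof -
  have "applicable (reduct P {}) {} = {}"
  proof (rule ccontr)
    assume "applicable (reduct P {}) {} \<noteq> {}"
    then obtain r where r: "r \<in> P" "\<And>A. NotLit A \<in> bd r \<Longrightarrow> \<not> sat_atom {} A"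
      "\<And>A. PosLit A \<in> bd r \<Longrightarrow> sat_atom {} A"
      by (auto simp: applicable_def reduct_def sat_body_def bd_def) force
    have "sat_literal {} L" if "L \<in> bd r" for L
      using that r by (cases L) (auto simp: sat_atom_def)
    with r(1) assms show False
      by (auto simp: applicable_def sat_body_def)
  qed
  then have "computation (reduct P {}) (\<lambda>_. {})"
    using horn_reduct by (simp add: computation_def Tnd_def)
  then show "stable_model P {}"
    unfolding stable_model_def derivable_model_def by (intro exI [of _ "\<lambda>_. {}"]) simp
  show "\<not> quasi_computation P X"
  proof
    assume "quasi_computation P X"
    then obtain r where "X 0 = {}" "\<forall>n. r n \<in> P \<and> sat_body (X n) (r n)"
      unfolding quasi_computation_def by blast
    then have "r 0 \<in> applicable P {}"
      by (metis (mono_tags, lifting) applicable_def mem_Collect_eq)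
    with assms show False by simp
  qed
qed

end

theory Submission imports Defs begin

text \<open>
  Satisfaction of a positive body is monotone, and it is compact: bodies and atom sets are
  finite, so whatever holds in the union of a chain holds from some stage on.  Compactness makes
  every derivable model a model, and every clause used by a quasi-computation with result \<open>M\<close>
  survives in the reduct with respect to \<open>M\<close>.  The quasi-computation is then dominated by the
  canonical computation \<open>Y \<mapsto> hset(Q(Y)) \<inter> M\<close> of the reduct \<open>Q\<close>.

  Conversely, a computation of the reduct is serialized: one clause \<open>r\<close> is fired at a
  time, adding \<open>hset(r) \<inter> M\<close>.  A scheduler that targets each atom of the countable set \<open>M\<close>
  infinitely often makes the result exhaust \<open>M\<close>.
\<close>

section \<open>Monotonicity and compactness of satisfaction\<close>

lemma sat_atom_mono:
  assumes "sat_atom S A" "S \<subseteq> T"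
  shows "sat_atom T A"
proof -
  have "card (S \<inter> aset A) \<le> card (T \<inter> aset A)"
    using assms(2) finite_aset [of A] by (intro card_mono) auto
  with assms(1) show ?thesis
    by (simp add: sat_atom_def)
qed

text \<open>An mc-atom sees only its own atoms. So \<open>hset r \<inter> M\<close>, the largest
  choice of head atoms inside \<open>M\<close>, satisfies the head as soon as \<open>M\<close> does;
  both constructions below add atoms in this way.\<close>

lemma sat_atom_Int_hset: "sat_atom (hset r \<inter> S) (head r) \<longleftrightarrow> sat_atom S (head r)"
  by (simp add: sat_atom_def hset_def Int_ac)

text \<open>Phrased with a filter, so that finitely many atoms here, and finitely many body literals
  later, are combined by \<open>eventually_ball_finite\<close> without computing a maximal
  stage.\<close>

lemma eventually_sat_atom:
  fixes X :: "nat \<Rightarrow> 'a set"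
  assumes "mono X" "sat_atom (\<Union>n. X n) A"
  shows "\<forall>\<^sub>F n in sequentially. sat_atom (X n) A"
proof -
  have "\<forall>\<^sub>F n in sequentially. a \<in> X n" if "a \<in> (\<Union>n. X n) \<inter> aset A" for a
    using that assms(1) by (fastforce simp: eventually_sequentially dest: monoD)
  then have "\<forall>\<^sub>F n in sequentially. \<forall>a\<in>(\<Union>n. X n) \<inter> aset A. a \<in> X n"
    by (intro eventually_ball_finite) (auto simp: finite_aset)
  then show ?thesis
  proof eventually_elim
    case (elim n)
    then have "X n \<inter> aset A = (\<Union>n. X n) \<inter> aset A"
      by auto
    with assms(2) show ?case
      by (simp add: sat_atom_def)
  qed
qed

lemma sat_literal_not_iff: "sat_literal S (NotLit A) \<longleftrightarrow> \<not> sat_atom S A"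
  by (auto simp: sat_atom_def)

lemma horn_sat_body_iff:
  assumes "horn Q" "r \<in> Q"
  shows "sat_body S r \<longleftrightarrow> (\<forall>A. PosLit A \<in> bd r \<longrightarrow> sat_atom S A)"
proof -
  have "\<exists>A. L = PosLit A" if "L \<in> bd r" for L
    using assms that by (cases L) (auto simp: horn_def)
  then show ?thesis
    unfolding sat_body_def by (metis sat_literal.simps(1))
qed

lemma horn_sat_body_mono:
  assumes "horn Q" "r \<in> Q" "sat_body S r" "S \<subseteq> T"
  shows "sat_body T r"
  using assms sat_atom_mono by (metis horn_sat_body_iff)

lemma horn_eventually_sat_body:
  fixes X :: "nat \<Rightarrow> 'a set"
  assumes "horn Q" "r \<in> Q" "mono X" "sat_body (\<Union>n. X n) r"
  shows "\<forall>\<^sub>F n in sequentially. sat_body (X n) r"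
  unfolding sat_body_def
proof (rule eventually_ball_finite)
  show "finite (bd r)"
    by (simp add: bd_def)
  show "\<forall>L\<in>bd r. \<forall>\<^sub>F n in sequentially. sat_literal (X n) L"
  proof
    fix L assume L: "L \<in> bd r"
    then obtain A where A: "L = PosLit A"
      using assms(1,2) by (cases L) (auto simp: horn_def)
    have "sat_atom (\<Union>n. X n) A"
      using assms(4) L unfolding sat_body_def A by force
    then show "\<forall>\<^sub>F n in sequentially. sat_literal (X n) L"
      using eventually_sat_atom [OF assms(3)] by (simp add: A)
  qed
qed

section \<open>Derivable models of Horn programs\<close>

lemma computation_mono:
  assumes "computation Q X"
  shows "mono X"
  using assms by (simp add: computation_def mono_iff_le_Suc)

lemma derivable_model_is_model:
  assumes "derivable_model Q M"
  shows "model Q M"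
  unfolding model_def sat_clause_def
proof (intro ballI impI)
  fix r assume r: "r \<in> Q" "sat_body M r"
  from assms obtain X where X: "computation Q X" and M: "M = (\<Union>n. X n)"
    unfolding derivable_model_def by blast
  from X have "horn Q"
    by (simp add: computation_def)
  then have "\<forall>\<^sub>F n in sequentially. sat_body (X n) r"
    using horn_eventually_sat_body [OF _ r(1) computation_mono [OF X]] r(2) M by simp
  then obtain n where "sat_body (X n) r"
    by (auto simp: eventually_sequentially)
  with r(1) have "r \<in> applicable Q (X n)"
    by (simp add: applicable_def)
  with X have "sat_atom (X (Suc n)) (head r)"
    by (auto simp: computation_def Tnd_def)
  then show "sat_atom M (head r)"
    by (rule sat_atom_mono) (auto simp: M)
qed

text \<open>The chain \<open>X\<close> may fire only some of the applicable clauses, whereas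
  \<open>Tnd\<close> asks for all their heads. It therefore serves only as a lower bound for a
  genuine computation \<open>Y\<close> that stays inside \<open>M\<close>.\<close>

lemma derivable_model_chainI:
  assumes "horn Q" "model Q M" "M = (\<Union>n. X n)" "X 0 = {}"
    and step: "\<And>n. X (Suc n) \<subseteq> X n \<union> hset_program (applicable Q (X n))"
  shows "derivable_model Q M"
proof -
  \<comment> \<open>For \<open>S \<subseteq> M\<close> this is the largest element of
    \<open>Tnd Q S\<close> inside \<open>M\<close>: since \<open>M\<close> is a model, it satisfies
    the heads of all clauses applicable at \<open>S\<close>.\<close>
  define F where "F = (\<lambda>S. hset_program (applicable Q S) \<inter> M)"
  define Y where "Y n = (F ^^ n) {}" for n
  have F_mono: "F S \<subseteq> F T" if "S \<subseteq> T" for S T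
    using horn_sat_body_mono [OF assms(1) _ _ that]
    by (auto simp: F_def hset_program_def applicable_def)
  have Y: "Y 0 = {}" "Y (Suc n) = F (Y n)" for n
    by (simp_all add: Y_def)
  have Y_M: "Y n \<subseteq> M" for n
    by (cases n) (auto simp: Y F_def)
  have Y_mono: "Y n \<subseteq> Y (Suc n)" for n
    by (induction n) (auto simp: Y(1) Y(2) intro: F_mono [THEN subsetD])
  have "Y (Suc n) \<in> Tnd Q (Y n)" for n
    unfolding Tnd_def
  proof (intro CollectI conjI ballI)
    show "Y (Suc n) \<subseteq> hset_program (applicable Q (Y n))"
      by (auto simp: Y F_def)
    fix r assume r: "r \<in> applicable Q (Y n)"
    then have "r \<in> Q" "sat_body M r"
      using horn_sat_body_mono [OF assms(1) _ _ Y_M] by (auto simp: applicable_def)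
    with assms(2) have "sat_atom M (head r)"
      by (simp add: model_def sat_clause_def)
    then have "sat_atom (hset r \<inter> M) (head r)"
      by (simp add: sat_atom_Int_hset)
    then show "sat_atom (Y (Suc n)) (head r)"
      by (rule sat_atom_mono) (use r in \<open>auto simp: Y F_def hset_program_def\<close>)
  qed
  with Y_mono Y(1) assms(1) have "computation Q Y"
    by (simp add: computation_def)
  moreover have "X n \<subseteq> Y n" for n
  proof (induction n)
    case 0
    show ?case by (simp add: assms(4))
  next
    case (Suc n)
    \<comment> \<open>\<open>F\<close> keeps only atoms of \<open>M\<close>, hence the intersection;
      it disappears at the end because \<open>M\<close> is the union of the chain.\<close>
    have "X (Suc n) \<inter> M \<subseteq> X n \<union> F (X n)"
      using step [of n] by (auto simp: F_def)
    also have "\<dots> \<subseteq> Y (Suc n)"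
      using Suc Y_mono [of n] F_mono [OF Suc] by (auto simp: Y(2))
    finally show ?case
      using assms(3) by auto
  qed
  then have "M = (\<Union>n. Y n)"
    using Y_M unfolding assms(3) by blast
  ultimately show ?thesis
    unfolding derivable_model_def by blast
qed

section \<open>The reduct, clause by clause\<close>

definition positive_part :: "'a mca_clause \<Rightarrow> 'a mca_clause" where
  "positive_part r = Clause (head r) (filter (\<lambda>L. \<nexists>A. L = NotLit A) (body r))"

lemma hset_positive_part [simp]: "hset (positive_part r) = hset r"
  and head_positive_part [simp]: "head (positive_part r) = head r"
  by (simp_all add: positive_part_def hset_def)

lemma sat_body_positive_part:
  "sat_body S r \<longleftrightarrow>
    sat_body S (positive_part r) \<and> (\<forall>A. NotLit A \<in> bd r \<longrightarrow> \<not> sat_atom S A)"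
proof -
  have "bd r = bd (positive_part r) \<union> NotLit ` {A. NotLit A \<in> bd r}"
    by (auto simp: bd_def positive_part_def)
  then have "sat_body S r \<longleftrightarrow>
      (\<forall>L \<in> bd (positive_part r) \<union> NotLit ` {A. NotLit A \<in> bd r}. sat_literal S L)"
    unfolding sat_body_def by (rule arg_cong)
  then show ?thesis
    by (simp add: ball_Un sat_literal_not_iff sat_body_def [of S "positive_part r"] del: sat_literal.simps)
qed

lemma mem_reduct_iff:
  "q \<in> reduct P M \<longleftrightarrow>
    (\<exists>r\<in>P. q = positive_part r \<and> (\<forall>A. NotLit A \<in> bd r \<longrightarrow> \<not> sat_atom M A))"
  by (auto simp: reduct_def positive_part_def)

text \<open>A clause removed from the reduct has a body that fails in \<open>M\<close>, so
  \<open>M\<close> satisfies it vacuously. For a surviving clause, \<open>M\<close> satisfies the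
  body iff it satisfies the positive part.\<close>

lemma model_reduct_iff: "model (reduct P M) M \<longleftrightarrow> model P M"
proof -
  have "(\<forall>r\<in>P. (\<forall>A. NotLit A \<in> bd r \<longrightarrow> \<not> sat_atom M A) \<longrightarrow> sat_clause M (positive_part r))
      \<longleftrightarrow> (\<forall>r\<in>P. sat_clause M r)"
    unfolding sat_clause_def by (subst (2) sat_body_positive_part) auto
  moreover have "model (reduct P M) M \<longleftrightarrow>
      (\<forall>r\<in>P. (\<forall>A. NotLit A \<in> bd r \<longrightarrow> \<not> sat_atom M A) \<longrightarrow> sat_clause M (positive_part r))"
    unfolding model_def Ball_def mem_reduct_iff by blast
  ultimately show ?thesis
    by (simp add: model_def)
qed

section \<open>From quasi-computations to stable models\<close>

lemma quasi_result_eq: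
  assumes "X 0 = {}"
  shows "quasi_result X = (\<Union>n. X n)"
proof -
  have "X n \<subseteq> quasi_result X" for n
    using assms by (cases n) (auto simp: quasi_result_def)
  then show ?thesis
    by (auto simp: quasi_result_def)
qed

lemma quasi_result_stable:
  assumes "model P M" "quasi_computation P X" "M = quasi_result X"
  shows "stable_model P M"
proof -
  from assms(2) obtain r where X0: "X 0 = {}" and r: "\<And>n. r n \<in> P"
    and body: "\<And>n. sat_body (X n) (r n)"
    and step: "\<And>n. \<exists>Y. Y \<subseteq> hset (r n) \<and> sat_atom Y (head (r n)) \<and> X (Suc n) = X n \<union> Y"
    and neg: "\<And>n i A. i \<le> n \<Longrightarrow> NotLit A \<in> bd (r i) \<Longrightarrow> \<not> sat_atom (X (Suc n)) A"
    unfolding quasi_computation_def by metis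
  have M: "M = (\<Union>n. X n)"
    using assms(3) quasi_result_eq [of X] X0 by simp
  have "mono X"
    using step unfolding mono_iff_le_Suc by blast
  have "\<not> sat_atom M A" if A: "NotLit A \<in> bd (r i)" for A i
  proof
    assume "sat_atom M A"
    then have "\<forall>\<^sub>F n in sequentially. sat_atom (X n) A"
      using eventually_sat_atom \<open>mono X\<close> M by blast
    then obtain N where "\<And>n. n \<ge> N \<Longrightarrow> sat_atom (X n) A"
      by (auto simp: eventually_sequentially)
    \<comment> \<open>This stage lies beyond \<open>N\<close>, and at step \<open>max i N\<close>
      the third condition on quasi-computations already covers the clause
      \<open>r i\<close>.\<close>
    then have "sat_atom (X (Suc (max i N))) A"
      by simp
    with neg [OF _ A, of "max i N"] show False
      by simp
  qed
  then have pos: "positive_part (r n) \<in> applicable (reduct P M) (X n)" for n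
    using r body [of n] sat_body_positive_part [of "X n" "r n"] by (auto simp: applicable_def mem_reduct_iff)
  have "X (Suc n) \<subseteq> X n \<union> hset_program (applicable (reduct P M) (X n))" for n
  proof -
    have "hset (r n) \<subseteq> hset_program (applicable (reduct P M) (X n))"
      using UN_upper [OF pos [of n], of hset] by (simp add: hset_program_def)
    with step [of n] show ?thesis
      by blast
  qed
  then show ?thesis
    unfolding stable_model_def
    using derivable_model_chainI [of "reduct P M" M X, OF horn_reduct _ M X0] assms(1) by (simp add: model_reduct_iff)
qed

section \<open>From stable models to quasi-computations\<close>

text \<open>
  The clause \<open>r\<^sub>0\<close> is fired whenever the targeted atom is not derivable in one step.
\<close>

lemma derivable_model_serialize:
  assumes "derivable_model Q M" "countable M" "r\<^sub>0 \<in> Q" "sat_body {} r\<^sub>0"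
  obtains X r where "X 0 = {}" "M = (\<Union>n. X n)"
    "\<And>n. r n \<in> Q" "\<And>n. sat_body (X n) (r n)" "\<And>n. X (Suc n) = X n \<union> (hset (r n) \<inter> M)"
proof -
  from assms(1) obtain Y where Y: "computation Q Y" and M: "M = (\<Union>n. Y n)"
    unfolding derivable_model_def by blast
  from Y have "horn Q"
    by (simp add: computation_def)
  have "\<exists>r. r \<in> applicable Q S \<and> (a \<in> hset_program (applicable Q S) \<longrightarrow> a \<in> hset r)" for a S
  proof (cases "a \<in> hset_program (applicable Q S)")
    case False
    have "r\<^sub>0 \<in> applicable Q S"
      using assms(3,4) horn_sat_body_mono [OF \<open>horn Q\<close>] by (auto simp: applicable_def)
    with False show ?thesis
      by blast
  qed (auto simp: hset_program_def)
  then have "\<exists>c. \<forall>a S. c a S \<in> applicable Q S \<and>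
      (a \<in> hset_program (applicable Q S) \<longrightarrow> a \<in> hset (c a S))"
    by (intro choice allI) blast
  then obtain c where c: "\<And>a S. c a S \<in> applicable Q S"
    "\<And>a S. a \<in> hset_program (applicable Q S) \<Longrightarrow> a \<in> hset (c a S)"
    by blast
  \<comment> \<open>The first component of the decoded pair selects the atom; the second is free, so
    each atom of \<open>M\<close> recurs at arbitrarily late stages.\<close>
  define t where "t n = from_nat_into M (fst (prod_decode n))" for n
  have t: "\<exists>n\<ge>N. t n = a" if "a \<in> M" for a N
  proof -
    from that obtain i where "from_nat_into M i = a"
      using from_nat_into_surj [OF assms(2)] by blast
    then have "t (prod_encode (i, N)) = a"
      by (simp add: t_def)
    then show ?thesis
      using le_prod_encode_2 by blast
  qed
  define X where "X = rec_nat {} (\<lambda>n S. S \<union> (hset (c (t n) S) \<inter> M))"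
  define r where "r n = c (t n) (X n)" for n
  have X: "X 0 = {}" "X (Suc n) = X n \<union> (hset (r n) \<inter> M)" for n
    by (simp_all add: X_def r_def)
  have "mono X"
    by (simp add: mono_iff_le_Suc X)
  have "Y k \<subseteq> (\<Union>n. X n)" for k
  proof (induction k)
    case 0
    show ?case using Y by (simp add: computation_def)
  next
    case (Suc k)
    show ?case
    proof
      fix a assume a: "a \<in> Y (Suc k)"
      then have "a \<in> M"
        using M by blast
      from a Y have "a \<in> hset_program (applicable Q (Y k))"
        by (auto simp: computation_def Tnd_def)
      then obtain q where q: "q \<in> Q" "sat_body (Y k) q" "a \<in> hset q"
        by (auto simp: hset_program_def applicable_def)
      have "sat_body (\<Union>n. X n) q"
        using horn_sat_body_mono [OF \<open>horn Q\<close> q(1,2) Suc] .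
      then have "\<forall>\<^sub>F n in sequentially. sat_body (X n) q"
        by (rule horn_eventually_sat_body [OF \<open>horn Q\<close> q(1) \<open>mono X\<close>])
      then obtain N where N: "\<And>n. n \<ge> N \<Longrightarrow> sat_body (X n) q"
        by (auto simp: eventually_sequentially)
      \<comment> \<open>From stage \<open>N\<close> on, \<open>q\<close> offers \<open>a\<close>.
        The clause fired when \<open>a\<close> is next targeted need not be \<open>q\<close>, but
        its head set contains \<open>a\<close>.\<close>
      from t [OF \<open>a \<in> M\<close>] obtain n where n: "n \<ge> N" "t n = a"
        by blast
      have "a \<in> hset_program (applicable Q (X n))"
        using q N [OF n(1)] by (auto simp: hset_program_def applicable_def)
      then have "a \<in> hset (r n)"
        using c(2) n(2) by (simp add: r_def)
      with \<open>a \<in> M\<close> have "a \<in> X (Suc n)"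
        by (simp add: X)
      then show "a \<in> (\<Union>n. X n)"
        by blast
    qed
  qed
  moreover have "X n \<subseteq> M" for n
    by (induction n) (auto simp: X)
  ultimately have "M = (\<Union>n. X n)"
    using M by blast
  moreover have "r n \<in> Q" "sat_body (X n) (r n)" for n
    using c(1) [of "t n" "X n"] by (auto simp: r_def applicable_def)
  ultimately show ?thesis
    using that X by blast
qed

text \<open>If no clause fires on the empty set, \<open>Tnd\<close> allows only the empty set there
  and a computation never leaves it. This supplies the fallback clause of the scheduler when
  \<open>M\<close> is nonempty.\<close>

lemma derivable_model_empty_applicable:
  assumes "derivable_model Q M" "M \<noteq> {}"
  shows "applicable Q {} \<noteq> {}"
proof
  assume *: "applicable Q {} = {}"
  from assms(1) obtain Y where Y: "computation Q Y" and M: "M = (\<Union>n. Y n)"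
    unfolding derivable_model_def by blast
  have "Y n = {}" for n
  proof (induction n)
    case (Suc n)
    have "Y (Suc n) \<in> Tnd Q (Y n)"
      using Y by (simp add: computation_def)
    with Suc * show ?case by (auto simp: Tnd_def hset_program_def)
  qed (use Y in \<open>simp add: computation_def\<close>)
  with assms(2) M show False
    by simp
qed

lemma stable_quasi_result:
  assumes "stable_model P M" "countable M" "M = {} \<Longrightarrow> applicable P {} \<noteq> {}"
  shows "\<exists>X. quasi_computation P X \<and> M = quasi_result X"
proof -
  have der: "derivable_model (reduct P M) M"
    using assms(1) by (simp add: stable_model_def)
  have "applicable (reduct P M) {} \<noteq> {}"
  proof (cases "M = {}")
    case True
    then obtain r where "r \<in> P" "sat_body {} r"
      using assms(3) by (auto simp: applicable_def)
    with True have "positive_part r \<in> applicable (reduct P M) {}"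
      using sat_body_positive_part [of "{}" r] by (auto simp: applicable_def mem_reduct_iff)
    then show ?thesis by blast
  qed (rule derivable_model_empty_applicable [OF der])
  then obtain r\<^sub>0 where "r\<^sub>0 \<in> reduct P M" "sat_body {} r\<^sub>0"
    by (auto simp: applicable_def)
  from derivable_model_serialize [OF der assms(2) this] obtain X q
    where X0: "X 0 = {}" and M: "M = (\<Union>n. X n)" and q: "\<And>n. q n \<in> reduct P M"
      and body: "\<And>n. sat_body (X n) (q n)"
      and step: "\<And>n. X (Suc n) = X n \<union> (hset (q n) \<inter> M)"
    by metis
  from q obtain r where r: "\<And>n. r n \<in> P" and qr: "\<And>n. q n = positive_part (r n)"
    and neg: "\<And>n A. NotLit A \<in> bd (r n) \<Longrightarrow> \<not> sat_atom M A"
    unfolding mem_reduct_iff by metis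
  have X_M: "X n \<subseteq> M" for n
    using M by blast
  \<comment> \<open>The negated atoms fail in all of \<open>M\<close>, hence at every stage below
    it; this gives the third condition for all pairs of clause and stage at once.\<close>
  have neg_X: "\<not> sat_atom (X n) A" if "NotLit A \<in> bd (r i)" for n i A
    using neg [OF that] sat_atom_mono [OF _ X_M] by blast
  have head: "sat_atom (hset (r n) \<inter> M) (head (r n))" for n
  proof -
    have "sat_body M (q n)"
      using horn_sat_body_mono [OF horn_reduct q body X_M] .
    then have "sat_atom M (head (q n))"
      using derivable_model_is_model [OF der] q by (simp add: model_def sat_clause_def)
    then show ?thesis
      by (simp add: qr sat_atom_Int_hset)
  qed
  have "\<exists>Y. Y \<subseteq> hset (r n) \<and> sat_atom Y (head (r n)) \<and> X (Suc n) = X n \<union> Y" for n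
    using head step by (intro exI [of _ "hset (r n) \<inter> M"]) (simp add: qr)
  moreover have "sat_body (X n) (r n)" for n
    using body neg_X by (simp add: sat_body_positive_part [of _ "r n"] qr)
  ultimately have "quasi_computation P X"
    unfolding quasi_computation_def using X0 r neg_X by blast
  then show ?thesis
    using M quasi_result_eq [of X] X0 by blast
qed

text \<open>The assumptions exclude the boundary cases shown by
  \<open>uncountable_stable_model\<close> and \<open>no_quasi_computation\<close>.\<close>

theorem theorem3:
  fixes P :: "'a mca_program" and M :: "'a set"
  assumes "countable M"
    and "M = {} \<Longrightarrow> applicable P {} \<noteq> {}"
  shows "stable_model P M \<longleftrightarrow>
    model P M \<and> (\<exists>X. quasi_computation P X \<and> M = quasi_result X)"
proof
  assume stable: "stable_model P M"
  then have "model P M"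
    using derivable_model_is_model model_reduct_iff unfolding stable_model_def by blast
  then show "model P M \<and> (\<exists>X. quasi_computation P X \<and> M = quasi_result X)"
    using stable_quasi_result [OF stable assms] by blast
next
  assume "model P M \<and> (\<exists>X. quasi_computation P X \<and> M = quasi_result X)"
  then show "stable_model P M"
    using quasi_result_stable by blast
qed

end
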